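(* Let $a,b,c,d,e$ be constants with $d+ka\neq 0$ for all integers $k\ge 0$, let $\sigma(x)=ax^2+bx+c$, $\tau(x)=dx+e$, $\lambda_n=-(an(n-1)+dn)$, and let $p_n(x)=k_nx^n+\dots$ ($n\in\mathbb N_0$, $k_n\ne0$) be polynomials of exact degree $n$. (Continuous case) If for all $n$, $\sigma(x)p_n''(x)+\tau(x)p_n'(x)+\lambda_np_n(x)=0$, then for all integers $n\ge1$ $$x\,p_n'(x)=\alpha_n^*\,p_{n+1}'(x)+\beta_n^*\,p_n'(x)+\gamma_n^*\,p_{n-1}'(x),$$ $$\sigma(x)\,p_n''(x)=a_n'\,p_{n+1}'(x)+b_n'\,p_n'(x)+c_n'\,p_{n-1}'(x),$$ $$p_n(x)=\widehat a_n\,p_{n+1}'(x)+\widehat b_n\,p_n'(x)+\widehat c_n\,p_{n-1}'(x),$$ where $$\alpha_n^*=\frac{n}{n+1}\frac{k_n}{k_{n+1}},\qquad \beta_n^*=\frac{-2bn(an+d-a)+d(b-e)}{(d+2an)(d-2a+2an)},$$ $$\gamma_n^*=-\frac{\big((n-1)(an+d-a)(4ca-b^2)+ae^2+d^2c-bed\big)\,n\,(an+d-a)}{(d-2a+2an)^2(2an-3a+d)(2an-a+d)}\frac{k_n}{k_{n-1}},$$ $$a_n'=\frac{an(n-1)}{n+1}\frac{k_n}{k_{n+1}},\qquad b_n'=-\frac{(n-1)(an+d)(2ea-db)}{(d+2an)(d-2a+2an)},$$ $$c_n'=\frac{\big((n-1)(an+d-a)(4ca-b^2)+ae^2+d^2c-bed\big)(an+d)(an+d-a)\,n}{(d-2a+2an)^2(2an-3a+d)(2an-a+d)}\frac{k_n}{k_{n-1}},$$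 $$\widehat a_n=\frac1{n+1}\frac{k_n}{k_{n+1}},\qquad \widehat b_n=\frac{2ea-db}{(d+2an)(d-2a+2an)},$$ $$\widehat c_n=\frac{\big((n-1)(an+d-a)(4ca-b^2)+ae^2+d^2c-bed\big)\,an}{(d-2a+2an)^2(2an-3a+d)(2an-a+d)}\frac{k_n}{k_{n-1}}.$$ (Discrete case) If for all $n$, $\sigma(x)\Delta\nabla p_n(x)+\tau(x)\Delta p_n(x)+\lambda_np_n(x)=0$, then for all integers $n\ge1$ $$x\,\Delta p_n(x)=\alpha_n^*\,\Delta p_{n+1}(x)+\beta_n^*\,\Delta p_n(x)+\gamma_n^*\,\Delta p_{n-1}(x),$$ $$\sigma(x)\,\Delta\nabla p_n(x)=a_n'\,\Delta p_{n+1}(x)+b_n'\,\Delta p_n(x)+c_n'\,\Delta p_{n-1}(x),$$ $$p_n(x)=\widehat a_n\,\Delta p_{n+1}(x)+\widehat b_n\,\Delta p_n(x)+\widehat c_n\,\Delta p_{n-1}(x),$$ where, with $$G_n=(n-1)(d+an-a)(and-db-ad+a^2n^2-2a^2n+4ca+a^2+2ea-b^2)-dbe+d^2c+ae^2,$$ $$\alpha_n^*=\frac{n}{n+1}\frac{k_n}{k_{n+1}},\qquad \beta_n^*=\frac{-n(d+2a+2b)(d+an-a)-d(e-a-b)}{(2an-2a+d)(d+2an)},$$ $$\gamma_n^*=-G_n\,\frac{(d+an-a)\,n}{(d-a+2an)(d+2an-3a)(2an-2a+d)^2}\frac{k_n}{k_{n-1}},$$ $$a_n'=\frac{an(n-1)}{n+1}\frac{k_n}{k_{n+1}},\qquad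 b_n'=-\frac{(n-1)(an+d)(2and-ad-db+2ea-2a^2n+2a^2n^2)}{(2an-2a+d)(d+2an)},$$ $$c_n'=G_n\,\frac{(d+an-a)(an+d)\,n}{(d-a+2an)(d+2an-3a)(2an-2a+d)^2}\frac{k_n}{k_{n-1}},$$ $$\widehat a_n=\frac1{n+1}\frac{k_n}{k_{n+1}},\qquad \widehat b_n=\frac{-2an(d+an-a)-db+ad-d^2+2ea}{(2an-2a+d)(d+2an)},$$ $$\widehat c_n=G_n\,\frac{an}{(d-a+2an)(d+2an-3a)(2an-2a+d)^2}\frac{k_n}{k_{n-1}}.$$
   Context: $\mathbb N_0=\{0,1,2,\dots\}$. $\Delta y(x)=y(x+1)-y(x)$ and $\nabla y(x)=y(x)-y(x-1)$. The condition $d+ka\ne0$ ($k\ge0$) says exactly that for each $n$ the equation determines its polynomial solution of degree $n$ uniquely up to a constant factor. For $n=1$ the terms containing $p_0'$ or $\Delta p_0$ (the zero polynomial) are taken to be zero, whatever their coefficient. *)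

theory Defs
  imports "HOL-Computational_Algebra.Polynomial"
begin

definition fwd_diff :: "('a::ring_1 \<Rightarrow> 'a) \<Rightarrow> 'a \<Rightarrow> 'a" where
  "fwd_diff y x = y (x + 1) - y x"

definition bwd_diff :: "('a::ring_1 \<Rightarrow> 'a) \<Rightarrow> 'a \<Rightarrow> 'a" where
  "bwd_diff y x = y x - y (x - 1)"

text \<open>
  Below, the index \<open>n\<close> occurring in a formula is an element of the field (the image of a natural
  number), so that \<open>n - 1\<close> is not truncated; \<open>m\<close> is the natural number itself. At \<open>m = 1\<close>
  the factor \<open>2 * a * n - 3 * a + d\<close> of some denominators may vanish; the coefficients concerned
  then multiply the derivative or difference of a constant, so their value is irrelevant.
\<close>

definition sigma :: "'a::field_char_0 \<Rightarrow> 'a \<Rightarrow> 'a \<Rightarrow> 'a \<Rightarrow> 'a" where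
  "sigma a b c x = a * x^2 + b * x + c"

definition tau :: "'a::field_char_0 \<Rightarrow> 'a \<Rightarrow> 'a \<Rightarrow> 'a" where
  "tau d e x = d * x + e"

definition eigenval :: "'a::field_char_0 \<Rightarrow> 'a \<Rightarrow> nat \<Rightarrow> 'a" where
  "eigenval a d m = (let n = of_nat m in - (a * n * (n - 1) + d * n))"

definition alpha_star :: "(nat \<Rightarrow> 'a::field_char_0) \<Rightarrow> nat \<Rightarrow> 'a" where
  "alpha_star k m = (let n = of_nat m in n / (n + 1) * (k m / k (m + 1)))"

definition a_prime :: "'a::field_char_0 \<Rightarrow> (nat \<Rightarrow> 'a) \<Rightarrow> nat \<Rightarrow> 'a" where
  "a_prime a k m = (let n = of_nat m in a * n * (n - 1) / (n + 1) * (k m / k (m + 1)))"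

definition a_hat :: "(nat \<Rightarrow> 'a::field_char_0) \<Rightarrow> nat \<Rightarrow> 'a" where
  "a_hat k m = (let n = of_nat m in 1 / (n + 1) * (k m / k (m + 1)))"


subsection \<open>Continuous case\<close>

definition cont_beta_star :: "'a::field_char_0 \<Rightarrow> 'a \<Rightarrow> 'a \<Rightarrow> 'a \<Rightarrow> nat \<Rightarrow> 'a" where
  "cont_beta_star a b d e m = (let n = of_nat m in
     (- 2 * b * n * (a * n + d - a) + d * (b - e))
       / ((d + 2 * a * n) * (d - 2 * a + 2 * a * n)))"

definition cont_gamma_star ::
    "'a::field_char_0 \<Rightarrow> 'a \<Rightarrow> 'a \<Rightarrow> 'a \<Rightarrow> 'a \<Rightarrow> (nat \<Rightarrow> 'a) \<Rightarrow> nat \<Rightarrow> 'a" where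
  "cont_gamma_star a b c d e k m = (let n = of_nat m in
     - (((n - 1) * (a * n + d - a) * (4 * c * a - b^2) + a * e^2 + d^2 * c - b * e * d)
          * n * (a * n + d - a)
        / ((d - 2 * a + 2 * a * n)^2 * (2 * a * n - 3 * a + d) * (2 * a * n - a + d)))
     * (k m / k (m - 1)))"

definition cont_b_prime :: "'a::field_char_0 \<Rightarrow> 'a \<Rightarrow> 'a \<Rightarrow> 'a \<Rightarrow> nat \<Rightarrow> 'a" where
  "cont_b_prime a b d e m = (let n = of_nat m in
     - ((n - 1) * (a * n + d) * (2 * e * a - d * b)
        / ((d + 2 * a * n) * (d - 2 * a + 2 * a * n))))"

definition cont_c_prime ::
    "'a::field_char_0 \<Rightarrow> 'a \<Rightarrow> 'a \<Rightarrow> 'a \<Rightarrow> 'a \<Rightarrow> (nat \<Rightarrow> 'a) \<Rightarrow> nat \<Rightarrow> 'a" where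
  "cont_c_prime a b c d e k m = (let n = of_nat m in
     ((n - 1) * (a * n + d - a) * (4 * c * a - b^2) + a * e^2 + d^2 * c - b * e * d)
          * (a * n + d) * (a * n + d - a) * n
        / ((d - 2 * a + 2 * a * n)^2 * (2 * a * n - 3 * a + d) * (2 * a * n - a + d))
     * (k m / k (m - 1)))"

definition cont_b_hat :: "'a::field_char_0 \<Rightarrow> 'a \<Rightarrow> 'a \<Rightarrow> 'a \<Rightarrow> nat \<Rightarrow> 'a" where
  "cont_b_hat a b d e m = (let n = of_nat m in
     (2 * e * a - d * b) / ((d + 2 * a * n) * (d - 2 * a + 2 * a * n)))"

definition cont_c_hat ::
    "'a::field_char_0 \<Rightarrow> 'a \<Rightarrow> 'a \<Rightarrow> 'a \<Rightarrow> 'a \<Rightarrow> (nat \<Rightarrow> 'a) \<Rightarrow> nat \<Rightarrow> 'a" where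
  "cont_c_hat a b c d e k m = (let n = of_nat m in
     ((n - 1) * (a * n + d - a) * (4 * c * a - b^2) + a * e^2 + d^2 * c - b * e * d)
          * a * n
        / ((d - 2 * a + 2 * a * n)^2 * (2 * a * n - 3 * a + d) * (2 * a * n - a + d))
     * (k m / k (m - 1)))"


subsection \<open>Discrete case\<close>

definition disc_G :: "'a::field_char_0 \<Rightarrow> 'a \<Rightarrow> 'a \<Rightarrow> 'a \<Rightarrow> 'a \<Rightarrow> nat \<Rightarrow> 'a" where
  "disc_G a b c d e m = (let n = of_nat m in
     (n - 1) * (d + a * n - a)
       * (a * n * d - d * b - a * d + a^2 * n^2 - 2 * a^2 * n + 4 * c * a + a^2 + 2 * e * a - b^2)
     - d * b * e + d^2 * c + a * e^2)"

definition disc_beta_star :: "'a::field_char_0 \<Rightarrow> 'a \<Rightarrow> 'a \<Rightarrow> 'a \<Rightarrow> nat \<Rightarrow> 'a" where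
  "disc_beta_star a b d e m = (let n = of_nat m in
     (- n * (d + 2 * a + 2 * b) * (d + a * n - a) - d * (e - a - b))
       / ((2 * a * n - 2 * a + d) * (d + 2 * a * n)))"

definition disc_gamma_star ::
    "'a::field_char_0 \<Rightarrow> 'a \<Rightarrow> 'a \<Rightarrow> 'a \<Rightarrow> 'a \<Rightarrow> (nat \<Rightarrow> 'a) \<Rightarrow> nat \<Rightarrow> 'a" where
  "disc_gamma_star a b c d e k m = (let n = of_nat m in
     - disc_G a b c d e m
       * ((d + a * n - a) * n
          / ((d - a + 2 * a * n) * (d + 2 * a * n - 3 * a) * (2 * a * n - 2 * a + d)^2))
     * (k m / k (m - 1)))"

definition disc_b_prime :: "'a::field_char_0 \<Rightarrow> 'a \<Rightarrow> 'a \<Rightarrow> 'a \<Rightarrow> nat \<Rightarrow> 'a" where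
  "disc_b_prime a b d e m = (let n = of_nat m in
     - ((n - 1) * (a * n + d)
          * (2 * a * n * d - a * d - d * b + 2 * e * a - 2 * a^2 * n + 2 * a^2 * n^2)
        / ((2 * a * n - 2 * a + d) * (d + 2 * a * n))))"

definition disc_c_prime ::
    "'a::field_char_0 \<Rightarrow> 'a \<Rightarrow> 'a \<Rightarrow> 'a \<Rightarrow> 'a \<Rightarrow> (nat \<Rightarrow> 'a) \<Rightarrow> nat \<Rightarrow> 'a" where
  "disc_c_prime a b c d e k m = (let n = of_nat m in
     disc_G a b c d e m
       * ((d + a * n - a) * (a * n + d) * n
          / ((d - a + 2 * a * n) * (d + 2 * a * n - 3 * a) * (2 * a * n - 2 * a + d)^2))
     * (k m / k (m - 1)))"

definition disc_b_hat :: "'a::field_char_0 \<Rightarrow> 'a \<Rightarrow> 'a \<Rightarrow> 'a \<Rightarrow> nat \<Rightarrow> 'a" where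
  "disc_b_hat a b d e m = (let n = of_nat m in
     (- 2 * a * n * (d + a * n - a) - d * b + a * d - d^2 + 2 * e * a)
       / ((2 * a * n - 2 * a + d) * (d + 2 * a * n)))"

definition disc_c_hat ::
    "'a::field_char_0 \<Rightarrow> 'a \<Rightarrow> 'a \<Rightarrow> 'a \<Rightarrow> 'a \<Rightarrow> (nat \<Rightarrow> 'a) \<Rightarrow> nat \<Rightarrow> 'a" where
  "disc_c_hat a b c d e k m = (let n = of_nat m in
     disc_G a b c d e m
       * (a * n
          / ((d - a + 2 * a * n) * (d + 2 * a * n - 3 * a) * (2 * a * n - 2 * a + d)^2))
     * (k m / k (m - 1)))"

end

theory Submission
  imports Defs
begin


text \<open>
  Both cases are instances of one calculus with a step \<open>h\<close>: an operator \<open>D\<close> (the derivative for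
  \<open>h = 0\<close>, the forward difference for \<open>h = 1\<close>) and an operator \<open>E\<close> (the second derivative, or the
  forward difference of the backward difference) that are determined by their product rules with the
  variable \<open>x\<close>. The coefficients of the two cases are the values at \<open>h = 0\<close> and \<open>h = 1\<close> of
  polynomial expressions in \<open>h\<close>.

  Write \<open>q\<^sub>n = D p\<^sub>n\<close>. Applying \<open>D\<close> to the equation of \<open>p\<^sub>n\<close> shows that \<open>q\<^sub>n\<close> is an eigenvector of
  an operator \<open>M = \<sigma> E + \<tau>' D\<close> of the same kind (\<open>M_q\<close>), with eigenvalue
  \<open>\<mu>\<^sub>n = (n - 1)(a n + d)\<close>, called \<open>eigval n\<close> below; by the condition on \<open>a\<close> and \<open>d\<close> these are distinct, so a polynomial
  eigenvector is known by its eigenvalue up to a constant factor (\<open>degree_eigenpoly\<close>). Let \<open>X\<close> also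
  denote multiplication by \<open>x\<close>. The double commutator \<open>[M, [M, X]]\<close> is a combination of
  \<open>M X + X M\<close>, \<open>M\<close>, \<open>X\<close> and the identity (\<open>double_commutator\<close>). Applied to \<open>q\<^sub>n\<close> it says that
  \<open>(M - \<mu>\<^sub>n\<^sub>+\<^sub>1)(M - \<mu>\<^sub>n\<^sub>-\<^sub>1)\<close> sends \<open>x q\<^sub>n\<close> to a multiple of \<open>q\<^sub>n\<close>. Hence \<open>x q\<^sub>n\<close> is a combination of
  \<open>q\<^sub>n\<^sub>+\<^sub>1\<close>, \<open>q\<^sub>n\<close> and \<open>q\<^sub>n\<^sub>-\<^sub>1\<close>. Its coefficients come from three sources: the first from comparing
  leading coefficients, the second from that multiple, the third from comparing coefficients of
  \<open>x\<^sup>n\<^sup>-\<^sup>2\<close>, for which the eigenvalue equation yields the top three coefficients of \<open>q\<^sub>n\<close>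
  (\<open>gamma_identity\<close>).

  The other two expansions follow from this one. By the equation, \<open>p\<^sub>n\<close> is a multiple of
  \<open>\<sigma> E p\<^sub>n + \<tau> q\<^sub>n\<close>, and the operator taking \<open>q\<^sub>n\<close> to this polynomial is built from the
  commutator \<open>[M, X]\<close>, \<open>M\<close>, \<open>X\<close> and constants, all of which act on the span of the \<open>q\<^sub>j\<close> in a known
  way (\<open>p_expansion\<close>). The equation then expresses \<open>\<sigma> E p\<^sub>n\<close> by \<open>x q\<^sub>n\<close>, \<open>q\<^sub>n\<close> and \<open>p\<^sub>n\<close>.
\<close>

section \<open>A common calculus for derivatives and differences\<close>

abbreviation X :: "'a::comm_semiring_1 poly" where "X \<equiv> [:0, 1:]"

lemma X_mult: "X * f = pCons 0 f" for f :: "'a::field_char_0 poly" by simp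

lemma const_double: "[:2 * r:] = 2 * [:r:]" for r :: "'a::field_char_0"
  by (metis add_pCons add_0 mult_2)

text \<open>
  The two product rules, linearity and the values at \<open>1\<close> determine \<open>D\<close> and \<open>E\<close> on all polynomials. For \<open>h \<noteq> 0\<close> the
  operators are the divided differences \<open>(f(x + h) - f(x)) / h\<close> and
  \<open>(f(x + h) - 2 f(x) + f(x - h)) / h\<^sup>2\<close>.
\<close>
locale step_calculus =
  fixes h :: "'a::field_char_0" and D E :: "'a poly \<Rightarrow> 'a poly"
  assumes D_one: "D 1 = 0" and E_one: "E 1 = 0"
    and D_add: "D (f + g) = D f + D g" and E_add: "E (f + g) = E f + E g"
    and D_smult: "D (smult r f) = smult r (D f)" and E_smult: "E (smult r f) = smult r (E f)"
    and D_X_mult: "D (X * f) = X * D f + f + smult h (D f)"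
    and E_X_mult: "E (X * f) = X * E f + 2 * D f - smult h (E f)"
begin

lemma D_const [simp]: "D [:r:] = 0" and E_const [simp]: "E [:r:] = 0"
  using D_smult[of r 1] E_smult[of r 1] by (simp_all add: D_one E_one)

lemma D_zero [simp]: "D 0 = 0" and E_zero [simp]: "E 0 = 0"
  using D_const[of 0] E_const[of 0] by simp_all

lemma D_const_mult: "D ([:r:] * f) = [:r:] * D f" and E_const_mult: "E ([:r:] * f) = [:r:] * E f"
  by (simp_all add: D_smult E_smult)

text \<open>
  Scalars are written as constant polynomials where an identity is to be settled by commutative ring
  arithmetic in the polynomials.
\<close>
lemma D_X_mult': "D (X * f) = X * D f + f + [:h:] * D f"
  and E_X_mult': "E (X * f) = X * E f + 2 * D f - [:h:] * E f"
  unfolding D_X_mult E_X_mult by simp_all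

lemma D_pCons: "D (pCons r f) = pCons 0 (D f) + f + smult h (D f)"
  and E_pCons: "E (pCons r f) = pCons 0 (E f) + 2 * D f - smult h (E f)"
proof -
  have eq: "pCons r f = [:r:] + X * f" by simp
  show "D (pCons r f) = pCons 0 (D f) + f + smult h (D f)"
    unfolding eq D_add D_X_mult by simp
  show "E (pCons r f) = pCons 0 (E f) + 2 * D f - smult h (E f)"
    unfolding eq E_add E_X_mult by simp
qed

lemma D_minus: "D (- f) = - D f" and E_minus: "E (- f) = - E f"
  using D_smult[of "-1" f] E_smult[of "-1" f] by simp_all

lemma D_diff: "D (f - g) = D f - D g" and E_diff: "E (f - g) = E f - E g"
  using D_add[of f "- g"] E_add[of f "- g"] by (simp_all add: D_minus E_minus)

lemma D_double: "D (2 * f) = 2 * D f" and E_double: "E (2 * f) = 2 * E f"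
  by (simp_all only: mult_2 D_add E_add)

lemma D_E_commute: "D (E f) = E (D f)"
proof (induction f)
  case 0 then show ?case by simp
next
  case (pCons r f)
  show ?case
    by (simp add: D_pCons E_pCons D_add E_add D_diff E_diff D_smult E_smult D_double E_double
        pCons.IH smult_add_right smult_diff_right)
qed

text \<open>
  For \<open>h = 1\<close> this is \<open>\<Delta>\<Delta> = \<Delta>\<nabla> + \<Delta>\<Delta>\<nabla>\<close>, that is \<open>\<Delta> = \<nabla> + \<Delta>\<nabla>\<close> composed with \<open>\<Delta>\<close>. It removes
  repeated applications of \<open>D\<close>, so that together with commutation every word in \<open>D\<close> and \<open>E\<close> has a
  normal form.
\<close>
lemma D_D: "D (D f) = E f + [:h:] * E (D f)"
proof (induction f)
  case 0 then show ?case by simp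
next
  case (pCons r f)
  have eq: "pCons r f = [:r:] + X * f" by simp
  show ?case unfolding eq
    by (simp only: D_add E_add D_X_mult' E_X_mult' D_zero E_zero D_const E_const D_const_mult E_const_mult
        D_diff D_double D_E_commute pCons.IH) algebra
qed

text \<open>
  The first three terms of \<open>D x\<^sup>n = n x\<^sup>n\<^sup>-\<^sup>1 + h (n choose 2) x\<^sup>n\<^sup>-\<^sup>2 + h\<^sup>2 (n choose 3) x\<^sup>n\<^sup>-\<^sup>3 + \<dots>\<close>; the
  degree bound makes the omitted ones vanish. The factor 6 clears the denominators of the binomial
  coefficients.
\<close>
lemma coeff_D:
  assumes "degree f \<le> i + 3"
  shows "6 * coeff (D f) i = 6 * (of_nat i + 1) * coeff f (Suc i)
    + 3 * h * (of_nat i + 1) * (of_nat i + 2) * coeff f (Suc (Suc i))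
    + h * h * (of_nat i + 1) * (of_nat i + 2) * (of_nat i + 3) * coeff f (Suc (Suc (Suc i)))"
  using assms
proof (induction f arbitrary: i)
  case 0 then show ?case by simp
next
  case (pCons r f)
  then have deg: "degree f \<le> i + 2" by (auto split: if_splits)
  then have "coeff f (Suc (Suc (Suc i))) = 0" by (simp add: coeff_eq_0)
  with pCons.IH[of i] deg
  have IHi: "6 * coeff (D f) i = 6 * (of_nat i + 1) * coeff f (Suc i)
    + 3 * h * (of_nat i + 1) * (of_nat i + 2) * coeff f (Suc (Suc i))"
    by simp
  show ?case (is "_ = ?rhs i")
  proof (cases i)
    case 0
    have "6 * coeff (D (pCons r f)) 0 = 6 * coeff f 0 + h * (6 * coeff (D f) 0)"
      by (simp add: D_pCons algebra_simps)
    also have "\<dots> = ?rhs 0"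
      unfolding IHi[unfolded 0] 0 coeff_pCons_Suc of_nat_0 by algebra
    finally show ?thesis unfolding 0 .
  next
    case (Suc j)
    have IHj: "6 * coeff (D f) j = 6 * (of_nat j + 1) * coeff f (Suc j)
      + 3 * h * (of_nat j + 1) * (of_nat j + 2) * coeff f (Suc (Suc j))
      + h * h * (of_nat j + 1) * (of_nat j + 2) * (of_nat j + 3) * coeff f (Suc (Suc (Suc j)))"
      using pCons.IH[of j] deg Suc by simp
    have "6 * coeff (D (pCons r f)) (Suc j)
        = 6 * coeff (D f) j + 6 * coeff f (Suc j) + h * (6 * coeff (D f) (Suc j))"
      by (simp add: D_pCons algebra_simps)
    also have "\<dots> = ?rhs (Suc j)"
      unfolding IHj IHi[unfolded Suc] Suc coeff_pCons_Suc of_nat_Suc by algebra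
    finally show ?thesis unfolding Suc .
  qed
qed

text \<open>
  Likewise \<open>E x\<^sup>n = n (n - 1) x\<^sup>n\<^sup>-\<^sup>2 + 2 h\<^sup>2 (n choose 4) x\<^sup>n\<^sup>-\<^sup>4 + \<dots>\<close>: the second difference is symmetric
  in \<open>h\<close>, so only even powers of \<open>h\<close> occur.
\<close>
lemma coeff_E:
  assumes "degree f \<le> i + 4"
  shows "12 * coeff (E f) i = 12 * (of_nat i + 1) * (of_nat i + 2) * coeff f (Suc (Suc i))
    + h * h * (of_nat i + 1) * (of_nat i + 2) * (of_nat i + 3) * (of_nat i + 4)
      * coeff f (Suc (Suc (Suc (Suc i))))"
  using assms
proof (induction f arbitrary: i)
  case 0 then show ?case by simp
next
  case (pCons r f)
  then have deg: "degree f \<le> i + 3" by (auto split: if_splits)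
  then have "coeff f (Suc (Suc (Suc (Suc i)))) = 0" by (simp add: coeff_eq_0)
  with pCons.IH[of i] deg
  have IHi: "12 * coeff (E f) i = 12 * (of_nat i + 1) * (of_nat i + 2) * coeff f (Suc (Suc i))"
    by simp
  note Di = coeff_D[OF deg]
  show ?case (is "_ = ?rhs i")
  proof (cases i)
    case 0
    have "12 * coeff (E (pCons r f)) 0 = 4 * (6 * coeff (D f) 0) - h * (12 * coeff (E f) 0)"
      by (simp add: E_pCons numeral_poly algebra_simps)
    also have "\<dots> = ?rhs 0"
      unfolding IHi[unfolded 0] Di[unfolded 0] 0 coeff_pCons_Suc of_nat_0 by algebra
    finally show ?thesis unfolding 0 .
  next
    case (Suc j)
    have IHj: "12 * coeff (E f) j = 12 * (of_nat j + 1) * (of_nat j + 2) * coeff f (Suc (Suc j))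
      + h * h * (of_nat j + 1) * (of_nat j + 2) * (of_nat j + 3) * (of_nat j + 4)
        * coeff f (Suc (Suc (Suc (Suc j))))"
      using pCons.IH[of j] deg Suc by simp
    have "12 * coeff (E (pCons r f)) (Suc j)
        = 12 * coeff (E f) j + 4 * (6 * coeff (D f) (Suc j)) - h * (12 * coeff (E f) (Suc j))"
      by (simp add: E_pCons numeral_poly algebra_simps)
    also have "\<dots> = ?rhs (Suc j)"
      unfolding IHj IHi[unfolded Suc] Di[unfolded Suc] Suc coeff_pCons_Suc of_nat_Suc by algebra
    finally show ?thesis unfolding Suc .
  qed
qed

end

section \<open>The operator of the differences and its commutators with the variable\<close>

locale hypergeometric_calculus = step_calculus h D E
  for h :: "'a::field_char_0" and D E :: "'a poly \<Rightarrow> 'a poly" +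
  fixes a b c d e :: 'a
begin

text \<open>
  \<open>\<tau>'\<close> is \<open>\<tau> + D \<sigma>\<close> corrected by \<open>h d\<close>, which is what the product rule produces when \<open>D\<close> is moved
  past \<open>\<sigma> E + \<tau> D\<close>; \<open>N\<close> is the commutator of \<open>M\<close> with multiplication by \<open>x\<close>.
\<close>
definition e' where "e' = e + h * d + b + h * a"
definition "\<sigma> = [:a:] * (X * X) + [:b:] * X + [:c:]"
definition "\<tau> = [:d:] * X + [:e:]"
definition "\<tau>' = [:d + 2 * a:] * X + [:e':]"
definition M where "M f = \<sigma> * E f + \<tau>' * D f"
definition N where "N f = 2 * (\<sigma> * D f) - [:h:] * (\<sigma> * E f) + \<tau>' * f + [:h:] * (\<tau>' * D f)"

lemma M_X_mult: "M (X * f) = X * M f + N f"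
  unfolding M_def N_def D_X_mult' E_X_mult' by algebra

lemma D_sigma_mult: "D (\<sigma> * f) = [:a:] * D (X * (X * f)) + [:b:] * D (X * f) + [:c:] * D f"
  and E_sigma_mult: "E (\<sigma> * f) = [:a:] * E (X * (X * f)) + [:b:] * E (X * f) + [:c:] * E f"
  and D_tau'_mult: "D (\<tau>' * f) = [:d + 2 * a:] * D (X * f) + [:e':] * D f"
  and E_tau'_mult: "E (\<tau>' * f) = [:d + 2 * a:] * E (X * f) + [:e':] * E f"
  and D_tau_mult: "D (\<tau> * f) = [:d:] * D (X * f) + [:e:] * D f"
  unfolding \<sigma>_def \<tau>'_def \<tau>_def distrib_right mult.assoc D_add E_add D_const_mult E_const_mult
  by (rule refl)+

text \<open>
  Intertwining relation: \<open>D\<close> carries the original operator to \<open>M + d\<close>, hence eigenvectors of the former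
  to eigenvectors of \<open>M\<close>.
\<close>
lemma D_hypergeometric: "D (\<sigma> * E f + \<tau> * D f) = M (D f) + [:d:] * D f"
proof -
  have sm: "smult r g = [:r:] * g" for r g by simp
  have e'': "[:e':] = [:e:] + [:h:] * [:d:] + [:b:] + [:h:] * [:a:]" by (simp add: e'_def)
  have da: "[:d + 2 * a:] = [:d:] + 2 * [:a:]" unfolding const_double[symmetric] by simp
  show ?thesis
    unfolding M_def D_add D_sigma_mult D_tau_mult D_X_mult D_D D_E_commute sm
    unfolding \<sigma>_def \<tau>_def \<tau>'_def e'' da
    by algebra
qed

text \<open>
  The relation that makes multiplication by \<open>x\<close> tridiagonal on the eigenvectors of \<open>M\<close>. The
  commutator of \<open>M\<close> with \<open>N\<close> would in general be an operator of higher order in \<open>D\<close> and \<open>E\<close>; that it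
  reduces to \<open>M\<close> and \<open>X\<close> uses that \<open>\<sigma>\<close> has degree two and \<open>\<tau>'\<close> degree one. The proof brings both
  sides into the normal form given by the product rules and \<open>D_D\<close>.
\<close>
lemma double_commutator:
  "M (N f) = N (M f) + [:2 * a:] * (M (X * f) + X * M f) + [:h * (d + 2 * a) + 2 * b:] * M f
    + [:d * (d + 2 * a):] * (X * f) + [:e' * d:] * f"
proof -
  have sm: "smult r g = [:r:] * g" for r g by simp
  \<comment> \<open>The coefficients of \<open>\<tau>'\<close> are kept as atoms; \<open>a\<close> and \<open>d + 2 a\<close> are independent, so \<open>d\<close> is eliminated.\<close>
  define Q where "Q = [:d + 2 * a:]"
  define T where "T = [:e':]"
  have s: "[:2 * a:] = 2 * [:a:]" "[:h * (d + 2 * a) + 2 * b:] = [:h:] * Q + 2 * [:b:]"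
    "[:d * (d + 2 * a):] = (Q - 2 * [:a:]) * Q" "[:e' * d:] = T * (Q - 2 * [:a:])"
    by (simp_all add: numeral_poly Q_def T_def algebra_simps)
  show ?thesis
    unfolding M_X_mult
    unfolding M_def N_def D_add E_add D_diff E_diff D_double E_double D_const_mult E_const_mult
      D_sigma_mult E_sigma_mult D_tau'_mult E_tau'_mult
    unfolding D_X_mult E_X_mult D_add E_add D_diff E_diff D_smult E_smult D_double E_double
      D_D D_E_commute sm
    unfolding D_add E_add D_const_mult E_const_mult D_X_mult' E_X_mult' D_D D_E_commute sm
    unfolding s
    unfolding \<sigma>_def \<tau>'_def Q_def[symmetric] T_def[symmetric]
    by algebra
qed

lemma M_add: "M (f + g) = M f + M g" and M_diff: "M (f - g) = M f - M g"
  and M_const_mult: "M ([:r:] * f) = [:r:] * M f"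
  unfolding M_def D_add E_add D_diff E_diff D_const_mult E_const_mult by algebra+

lemma N_const_mult: "N ([:r:] * f) = [:r:] * N f"
  unfolding N_def D_const_mult E_const_mult by algebra

text \<open>
  The eigenvalue of \<open>M\<close> on polynomials of degree \<open>n - 1\<close>, the degree of \<open>D p\<^sub>n\<close>.
\<close>
definition eigval where "eigval n = (of_nat n - 1) * (a * of_nat n + d)"

text \<open>
  \<open>M\<close> does not raise degrees, and its matrix on the monomials is upper triangular with the eigenvalues
  on the diagonal. The formula gives the diagonal and the next two entries of a row.
\<close>
lemma coeff_M:
  fixes f :: "'a poly" and j :: nat
  defines "t \<equiv> of_nat j :: 'a"
  assumes deg: "degree f \<le> j + 2"
  shows "12 * coeff (M f) j = 12 * (t * (a * (t + 1) + d)) * coeff f j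
    + (t + 1) * (12 * b * t + 6 * (d + 2 * a) * h * t + 12 * e') * coeff f (Suc j)
    + (t + 1) * (t + 2) * (a * h^2 * t * (t - 1) + 12 * c + 2 * (d + 2 * a) * h^2 * t + 6 * e' * h)
      * coeff f (Suc (Suc j))"
proof -
  have z: "coeff f (Suc (Suc (Suc j))) = 0" "coeff f (Suc (Suc (Suc (Suc j)))) = 0"
    using deg by (simp_all add: coeff_eq_0)
  have Ej: "12 * coeff (E f) j = 12 * (t + 1) * (t + 2) * coeff f (Suc (Suc j))"
    using coeff_E[of f j] deg by (simp add: z t_def)
  have Dj: "6 * coeff (D f) j = 6 * (t + 1) * coeff f (Suc j)
      + 3 * h * (t + 1) * (t + 2) * coeff f (Suc (Suc j))"
    using coeff_D[of f j] deg by (simp add: z t_def)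
  have XEj: "12 * coeff (X * E f) j = 12 * t * (t + 1) * coeff f (Suc j)"
  proof (cases j)
    case (Suc i)
    then show ?thesis using coeff_E[of f i] deg z by (simp add: t_def algebra_simps)
  qed (simp add: t_def)
  have XDj: "6 * coeff (X * D f) j = 6 * t * coeff f j + 3 * h * t * (t + 1) * coeff f (Suc j)
      + h * h * t * (t + 1) * (t + 2) * coeff f (Suc (Suc j))"
  proof (cases j)
    case (Suc i)
    then have "6 * coeff (D f) i = 6 * (of_nat i + 1) * coeff f (Suc i)
    + 3 * h * (of_nat i + 1) * (of_nat i + 2) * coeff f (Suc (Suc i))
    + h * h * (of_nat i + 1) * (of_nat i + 2) * (of_nat i + 3) * coeff f (Suc (Suc (Suc i)))"
      using coeff_D[of f i] deg by simp
    moreover have "of_nat i = t - 1" by (simp add: t_def Suc)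
    ultimately show ?thesis by (simp add: Suc algebra_simps)
  qed (simp add: t_def)
  have XXEj: "12 * coeff (X * (X * E f)) j = 12 * t * (t - 1) * coeff f j
      + h * h * t * (t - 1) * (t + 1) * (t + 2) * coeff f (Suc (Suc j))"
  proof (cases "j \<le> 1")
    case True
    then have "j = 0 \<or> j = Suc 0" by auto
    then show ?thesis by (auto simp: t_def)
  next
    case False
    then obtain i where i: "j = Suc (Suc i)" by (metis One_nat_def not0_implies_Suc not_less_eq_eq le0)
    then have "12 * coeff (E f) i = 12 * (of_nat i + 1) * (of_nat i + 2) * coeff f (Suc (Suc i))
    + h * h * (of_nat i + 1) * (of_nat i + 2) * (of_nat i + 3) * (of_nat i + 4)
      * coeff f (Suc (Suc (Suc (Suc i))))"
      using coeff_E[of f i] deg by simp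
    moreover have "of_nat i = t - 2" by (simp add: t_def i)
    ultimately show ?thesis by (simp add: i algebra_simps)
  qed
  have "M f = [:a:] * (X * (X * E f)) + [:b:] * (X * E f) + [:c:] * E f
      + [:d + 2 * a:] * (X * D f) + [:e':] * D f"
    unfolding M_def \<sigma>_def \<tau>'_def by algebra
  moreover have "coeff ([:r:] * g) j = r * coeff g j" for r and g :: "'a poly" by simp
  ultimately have "coeff (M f) j = a * coeff (X * (X * E f)) j + b * coeff (X * E f) j + c * coeff (E f) j
      + (d + 2 * a) * coeff (X * D f) j + e' * coeff (D f) j"
    by (simp only: coeff_add)
  then have "12 * coeff (M f) j = a * (12 * coeff (X * (X * E f)) j) + b * (12 * coeff (X * E f) j)
      + c * (12 * coeff (E f) j) + 2 * (d + 2 * a) * (6 * coeff (X * D f) j)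
      + 2 * e' * (6 * coeff (D f) j)"
    by algebra
  also have "\<dots> = 12 * (t * (a * (t + 1) + d)) * coeff f j
    + (t + 1) * (12 * b * t + 6 * (d + 2 * a) * h * t + 12 * e') * coeff f (Suc j)
    + (t + 1) * (t + 2) * (a * h^2 * t * (t - 1) + 12 * c + 2 * (d + 2 * a) * h^2 * t + 6 * e' * h)
      * coeff f (Suc (Suc j))"
    unfolding Ej Dj XEj XDj XXEj by algebra
  finally show ?thesis .
qed

text \<open>
  A difference of two eigenvalues factors as \<open>(i - j)(a (i + j - 1) + d)\<close>.
\<close>
lemma eigval_eq_iff:
  assumes adm: "\<And>j::nat. d + of_nat j * a \<noteq> 0"
  shows "eigval i = eigval j \<longleftrightarrow> i = j"
proof
  assume eq: "eigval i = eigval j"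
  show "i = j"
  proof (rule ccontr)
    assume ne: "i \<noteq> j"
    then obtain l where l: "i + j = Suc l" by (cases "i + j") auto
    have "eigval i - eigval j = (of_nat i - of_nat j) * (a * (of_nat (i + j) - 1) + d)"
      unfolding eigval_def of_nat_add by algebra
    also have "\<dots> = (of_nat i - of_nat j) * (d + of_nat l * a)"
      unfolding l by (simp add: algebra_simps)
    finally show False using eq ne adm[of l] by simp
  qed
qed simp

text \<open>
  The leading coefficient sees only the diagonal entry of \<open>M\<close>, so the eigenvalue determines the degree.
  In particular the eigenvalue with index \<open>0\<close> has no polynomial eigenvector.
\<close>
lemma degree_eigenpoly:
  assumes adm: "\<And>j::nat. d + of_nat j * a \<noteq> 0"
    and eig: "M f = [:eigval i:] * f" and "f \<noteq> 0"
  shows "i = Suc (degree f)"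
proof -
  let ?j = "degree f"
  have "12 * coeff (M f) ?j = 12 * (of_nat ?j * (a * (of_nat ?j + 1) + d)) * coeff f ?j"
    using coeff_M[of f ?j] by (simp add: coeff_eq_0)
  also have "of_nat ?j * (a * (of_nat ?j + 1) + d) = eigval (Suc ?j)"
    by (simp add: eigval_def algebra_simps)
  finally have "eigval i = eigval (Suc ?j)" using eig \<open>f \<noteq> 0\<close> by simp
  then show ?thesis using eigval_eq_iff[OF adm] by simp
qed

end

section \<open>The third coefficient as a rational identity\<close>

text \<open>
  The comparison of coefficients of \<open>x\<^sup>n\<^sup>-\<^sup>2\<close> in \<open>x q\<^sub>n - \<alpha> q\<^sub>n\<^sub>+\<^sub>1 - \<beta> q\<^sub>n\<close>, freed of polynomials. Here
  \<open>v = n - 1\<close> and \<open>P = 2 a (n - 1) + d\<close>; \<open>\<kappa>, s, t\<close> are the top three coefficients of \<open>q\<^sub>n\<close>, and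
  \<open>\<kappa>, s', t'\<close> those of \<open>\<alpha> q\<^sub>n\<^sub>+\<^sub>1\<close>. The equations for \<open>s, s', t, t'\<close> are rows of the eigenvalue
  equation. In these variables every denominator is a shift of \<open>P\<close> by a multiple of \<open>a\<close>, and the
  halves \<open>r = h / 2\<close> and \<open>g = b + r (d + 2 a)\<close> keep the identity polynomial.
\<close>
lemma gamma_identity:
  fixes P a v g e' c r \<kappa> s t s' t' h d b e G :: "'a::field_char_0"
  assumes h: "h = 2 * r"
    and d: "d = P - 2 * a * v"
    and b: "b = g - r * (d + 2 * a)"
    and e: "e = e' - h * d - b - h * a"
    and G: "G = v * (P - a * v) * (h^2 * (a * v * d + a^2 * v^2)
      - h * d * b + 4 * c * a + 2 * h * e * a - b^2) - d * b * e + d^2 * c + a * e^2"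
    and nz: "P + 2 * a \<noteq> 0"
    and s: "P * s = \<kappa> * v * (g * (v - 1) + e')"
    and s': "(P + 2 * a) * s' = \<kappa> * (v + 1) * (g * v + e')"
    and t: "12 * (P - a) * t = (v - 1) * (6 * g * (v - 2) + 6 * e') * s
       + v * (v - 1) * (2 * a * r^2 * (v - 2) * (v - 3) + 6 * c + 4 * (d + 2 * a) * r^2 * (v - 2)
          + 6 * e' * r) * \<kappa>"
    and t': "12 * (P + a) * t' = v * (6 * g * (v - 1) + 6 * e') * s'
       + (v + 1) * v * (2 * a * r^2 * (v - 1) * (v - 2) + 6 * c + 4 * (d + 2 * a) * r^2 * (v - 1)
          + 6 * e' * r) * \<kappa>"
    and \<beta>: "P * (P + 2 * a) * \<beta> = - (2 * g * (v * (d + a * (v + 1))) + e' * d)"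
  shows "(t - t' - \<beta> * s) * ((P + a) * (P - a) * P^2) = - G * (P - a * v) * v * \<kappa>"
proof -
  \<comment> \<open>\<open>s'\<close> and \<open>\<beta>\<close> have the denominator \<open>P + 2 a\<close>, which cancels only in the sum.\<close>
  let ?Z = "12 * (P + 2 * a)"
  have "(t - t' - \<beta> * s) * ((P + a) * (P - a) * P^2) * ?Z
     = (P + a) * P * (P + 2 * a) * (P * (12 * (P - a) * t))
      - (P - a) * P^2 * ((P + 2 * a) * (12 * (P + a) * t'))
      - 12 * ((P + a) * (P - a)) * (P * (P + 2 * a) * \<beta>) * (P * s)"
    by algebra
  also have "\<dots> = (P + a) * P * (P + 2 * a) * ((v - 1) * (6 * g * (v - 2) + 6 * e') * (P * s)
       + v * (v - 1) * (2 * a * r^2 * (v - 2) * (v - 3) + 6 * c + 4 * (d + 2 * a) * r^2 * (v - 2)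
          + 6 * e' * r) * (\<kappa> * P))
      - (P - a) * P^2 * (v * (6 * g * (v - 1) + 6 * e') * ((P + 2 * a) * s')
       + (v + 1) * v * (2 * a * r^2 * (v - 1) * (v - 2) + 6 * c + 4 * (d + 2 * a) * r^2 * (v - 1)
          + 6 * e' * r) * (\<kappa> * (P + 2 * a)))
      - 12 * ((P + a) * (P - a)) * (P * (P + 2 * a) * \<beta>) * (P * s)"
    unfolding t t' by algebra
  also have "\<dots> = (- G * (P - a * v) * v * \<kappa>) * ?Z"
    unfolding s s' \<beta> unfolding G e b d h by algebra
  finally show ?thesis using nz by (metis mult_eq_0_iff mult_right_cancel zero_neq_numeral)
qed

section \<open>Expansion of \<open>x q\<^sub>n\<close>\<close>

locale hypergeometric_family = hypergeometric_calculus h D E a b c d e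
  for h :: "'a::field_char_0" and D E :: "'a poly \<Rightarrow> 'a poly" and a b c d e :: 'a +
  fixes p :: "nat \<Rightarrow> 'a poly" and k :: "nat \<Rightarrow> 'a"
  assumes admissible: "\<And>j::nat. d + of_nat j * a \<noteq> 0"
    and degree_p: "\<And>n. degree (p n) = n"
    and lead_p: "\<And>n. lead_coeff (p n) = k n"
    and k_nonzero: "\<And>n. k n \<noteq> 0"
    and equation: "\<And>n. \<sigma> * E (p n) + \<tau> * D (p n) + [:eigenval a d n:] * p n = 0"
begin

definition "q n = D (p n)"
abbreviation "\<alpha> \<equiv> alpha_star k"

text \<open>
  At \<open>h = 0\<close> and \<open>h = 1\<close> the following expressions are the coefficients of the continuous and of the
  discrete case. The powers of \<open>h\<close> are those that make each expression homogeneous when \<open>x\<close>, \<open>b\<close>,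
  \<open>e\<close>, \<open>h\<close> have weight 1 and \<open>c\<close> has weight 2.
\<close>
definition "\<beta> m = (let n = of_nat m in (- n * (d * h + 2 * a * h + 2 * b) * (d + a * n - a)
  - d * (e - a * h - b)) / ((2 * a * n - 2 * a + d) * (d + 2 * a * n)))"
definition "G m = (let n = of_nat m in
     (n - 1) * (d + a * n - a)
       * (h^2 * (a * n * d - a * d + a^2 * n^2 - 2 * a^2 * n + a^2) - h * d * b
          + 4 * c * a + 2 * h * e * a - b^2)
     - d * b * e + d^2 * c + a * e^2)"
definition "\<gamma> m = (let n = of_nat m in
     - G m
       * ((d + a * n - a) * n
          / ((d - a + 2 * a * n) * (d + 2 * a * n - 3 * a) * (2 * a * n - 2 * a + d)^2))
     * (k m / k (m - 1)))"

lemma M_q: "M (q n) = [:eigval n:] * q n"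
proof -
  have "\<sigma> * E (p n) + \<tau> * D (p n) = [:- eigenval a d n:] * p n"
    using equation[of n] by (simp add: add_eq_0_iff2)
  then have "M (q n) + [:d:] * q n = [:- eigenval a d n:] * q n"
    unfolding q_def by (metis D_hypergeometric D_const_mult)
  then have "M (q n) = [:- eigenval a d n:] * q n - [:d:] * q n" by algebra
  also have "\<dots> = [:- eigenval a d n - d:] * q n" by (simp add: smult_diff_left)
  also have "- eigenval a d n - d = eigval n"
    by (simp add: eigenval_def eigval_def Let_def algebra_simps)
  finally show ?thesis .
qed

lemma coeff_q: "coeff (q (Suc n)) n = of_nat (Suc n) * k (Suc n)"
proof -
  have "6 * coeff (q (Suc n)) n = 6 * (of_nat (Suc n) * k (Suc n))"
    using coeff_D[of "p (Suc n)" n] degree_p[of "Suc n"] lead_p[of "Suc n"]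
    by (simp add: q_def coeff_eq_0 algebra_simps)
  then show ?thesis by (metis mult_left_cancel zero_neq_numeral)
qed

lemma coeff_q_eq_0: "n \<le> j \<Longrightarrow> coeff (q n) j = 0"
  using coeff_D[of "p n" j] degree_p[of n] by (simp add: q_def coeff_eq_0)

lemma degree_q: "degree (q n) \<le> n - 1"
  by (rule degree_le) (auto intro!: coeff_q_eq_0)

lemma denominators_nonzero: "d + 2 * a * of_nat n \<noteq> 0" "n \<ge> 1 \<Longrightarrow> d - a + 2 * a * of_nat n \<noteq> 0"
  "n \<ge> 1 \<Longrightarrow> 2 * a * of_nat n - 2 * a + d \<noteq> 0" "n \<ge> 2 \<Longrightarrow> d + 2 * a * of_nat n - 3 * a \<noteq> 0"
proof -
  have "d + 2 * a * of_nat n = d + of_nat (2 * n) * a" by simp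
  then show "d + 2 * a * of_nat n \<noteq> 0" using admissible by metis
next
  assume "n \<ge> 1"
  then obtain m where n: "n = Suc m" by (cases n) auto
  have "d - a + 2 * a * of_nat n = d + of_nat (2 * m + 1) * a"
    "2 * a * of_nat n - 2 * a + d = d + of_nat (2 * m) * a"
    by (simp_all add: n algebra_simps)
  then show "d - a + 2 * a * of_nat n \<noteq> 0" "2 * a * of_nat n - 2 * a + d \<noteq> 0"
    using admissible by metis+
next
  assume "n \<ge> 2"
  then obtain m where n: "n = Suc (Suc m)" by (metis add_2_eq_Suc le_Suc_ex)
  have "d + 2 * a * of_nat n - 3 * a = d + of_nat (2 * m + 1) * a"
    by (simp add: n algebra_simps)
  then show "d + 2 * a * of_nat n - 3 * a \<noteq> 0" using admissible by metis
qed

text \<open>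
  For \<open>n \<ge> 1\<close> it will turn out to be \<open>\<gamma>\<^sub>n q\<^sub>n\<^sub>-\<^sub>1\<close>.
\<close>
definition "remainder n = X * q n - [:\<alpha> n:] * q (n + 1) - [:\<beta> n:] * q n"

lemma beta_mult:
  assumes "n \<ge> 1"
  shows "\<beta> n * ((2 * a * of_nat n - 2 * a + d) * (d + 2 * a * of_nat n))
    = - of_nat n * (d * h + 2 * a * h + 2 * b) * (d + a * of_nat n - a) - d * (e - a * h - b)"
  using denominators_nonzero[of n] assms by (simp add: \<beta>_def Let_def)

text \<open>
  \<open>\<beta>\<^sub>n\<close> solves the \<open>q\<^sub>n\<close>-component of the quadratic equation for \<open>x q\<^sub>n\<close>: the right-hand side is the
  scalar by which the last terms of \<open>double_commutator\<close> act on \<open>q\<^sub>n\<close>.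
\<close>
lemma beta_eigval:
  assumes "n \<ge> 1"
  shows "\<beta> n * ((eigval n - eigval (n + 1)) * (eigval n - eigval (n - 1)))
    = (h * (d + 2 * a) + 2 * b) * eigval n + e' * d"
proof -
  from assms obtain m where n: "n = Suc m" by (cases n) auto
  define \<nu> :: 'a where "\<nu> = of_nat n"
  have \<nu>: "of_nat (n + 1) = \<nu> + 1" "of_nat (n - 1) = \<nu> - 1" by (simp_all add: \<nu>_def n)
  have "(eigval n - eigval (n + 1)) * (eigval n - eigval (n - 1)) = - ((2 * a * \<nu> - 2 * a + d) * (d + 2 * a * \<nu>))"
    unfolding eigval_def \<nu> \<nu>_def[symmetric] by algebra
  moreover have "\<beta> n * ((2 * a * \<nu> - 2 * a + d) * (d + 2 * a * \<nu>))
    = - \<nu> * (d * h + 2 * a * h + 2 * b) * (d + a * \<nu> - a) - d * (e - a * h - b)"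
    using beta_mult[OF assms] by (simp add: \<nu>_def)
  ultimately have "\<beta> n * ((eigval n - eigval (n + 1)) * (eigval n - eigval (n - 1)))
    = \<nu> * (d * h + 2 * a * h + 2 * b) * (d + a * \<nu> - a) + d * (e - a * h - b)"
    by simp
  also have "\<dots> = (h * (d + 2 * a) + 2 * b) * eigval n + e' * d"
    unfolding eigval_def e'_def \<nu>_def[symmetric] by algebra
  finally show ?thesis .
qed

text \<open>
  \<open>remainder n\<close> is annihilated by \<open>(M - \<mu>\<^sub>n\<^sub>+\<^sub>1)(M - \<mu>\<^sub>n\<^sub>-\<^sub>1)\<close>. For \<open>x q\<^sub>n\<close> the double commutator gives the
  quadratic equation whose roots are these two eigenvalues (\<open>sum\<close> and \<open>prod\<close> below are the relations
  of Vieta), up to a multiple of \<open>q\<^sub>n\<close> that the choice of \<open>\<beta>\<^sub>n\<close> removes.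
\<close>
lemma M_M_remainder:
  assumes "n \<ge> 1"
  shows "M (M (remainder n) - [:eigval (n - 1):] * remainder n)
    = [:eigval (n + 1):] * (M (remainder n) - [:eigval (n - 1):] * remainder n)"
proof -
  define \<nu> :: 'a where "\<nu> = of_nat n"
  have \<nu>: "of_nat (n + 1) = \<nu> + 1" "of_nat (n - 1) = \<nu> - 1"
    using assms by (simp_all add: \<nu>_def)
  let ?x = "X * q n" and ?l = "[:eigval n:]" and ?u = "[:eigval (n + 1):]" and ?v = "[:eigval (n - 1):]"
  have sum: "2 * ?l + [:2 * a:] = ?u + ?v"
    unfolding mult_2 by (simp add: eigval_def \<nu> \<nu>_def[symmetric] algebra_simps del: One_nat_def)
  have prod: "?l * ?l - [:2 * a:] * ?l - [:d * (d + 2 * a):] = ?u * ?v"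
    unfolding mult_2 by (simp add: eigval_def \<nu> \<nu>_def[symmetric] algebra_simps del: One_nat_def)
  have beta: "[:h * (d + 2 * a) + 2 * b:] * ?l + [:e' * d:] = [:\<beta> n:] * ((?l - ?u) * (?l - ?v))"
    using beta_eigval[OF assms] by (simp add: mult_ac)
  have Mx: "M ?x = ?l * ?x + N (q n)"
    by (simp add: M_X_mult M_q mult.left_commute del: mult_pCons_left)
  have "M (M ?x) = ?l * M ?x + M (N (q n))"
    unfolding Mx M_add M_const_mult ..
  also have "M (N (q n)) = ?l * (M ?x - ?l * ?x) + [:2 * a:] * (M ?x + ?l * ?x)
     + [:h * (d + 2 * a) + 2 * b:] * (?l * q n) + [:d * (d + 2 * a):] * ?x + [:e' * d:] * q n"
    unfolding double_commutator M_q N_const_mult Mx by algebra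
  also have "?l * M ?x + \<dots> = (2 * ?l + [:2 * a:]) * M ?x
     - (?l * ?l - [:2 * a:] * ?l - [:d * (d + 2 * a):]) * ?x
     + ([:h * (d + 2 * a) + 2 * b:] * ?l + [:e' * d:]) * q n"
    by algebra
  finally have MMx: "M (M ?x) = (?u + ?v) * M ?x - ?u * ?v * ?x
      + [:\<beta> n:] * ((?l - ?u) * (?l - ?v)) * q n"
    unfolding sum prod beta .
  show ?thesis
    unfolding remainder_def M_diff M_const_mult M_q MMx by algebra
qed

lemma alpha_lead: "\<alpha> n * (of_nat (Suc n) * k (Suc n)) = of_nat n * k n"
proof -
  have "of_nat n + 1 \<noteq> (0 :: 'a)" by (metis of_nat_Suc of_nat_neq_0 add.commute)
  then show ?thesis using k_nonzero[of "Suc n"]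
    by (simp add: alpha_star_def Let_def add.commute)
qed

lemma coeff_remainder_eq_0:
  assumes "n \<ge> 1" "n \<le> j"
  shows "coeff (remainder n) j = 0"
proof -
  from assms obtain m where n: "n = Suc m" by (cases n) auto
  have "coeff (X * q n) j = \<alpha> n * coeff (q (n + 1)) j"
  proof (cases "j = n")
    case True
    then show ?thesis
      using coeff_q[of m] coeff_q[of n] alpha_lead[of n] by (simp add: n)
  next
    case False
    then have "coeff (q n) (j - 1) = 0" "coeff (q (n + 1)) j = 0" "j = Suc (j - 1)"
      using assms by (auto intro!: coeff_q_eq_0)
    then show ?thesis by (metis X_mult coeff_pCons_Suc mult_zero_right)
  qed
  then show ?thesis using coeff_q_eq_0[of n j] assms by (simp add: remainder_def)
qed

text \<open>
  The factor \<open>M - \<mu>\<^sub>n\<^sub>+\<^sub>1\<close> can be cancelled: its eigenvectors have degree \<open>n\<close>, but \<open>\<alpha>\<^sub>n\<close> was chosen so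
  that the remainder, and with it its image under \<open>M\<close>, has smaller degree.
\<close>
lemma M_remainder:
  assumes n: "n \<ge> 1"
  shows "M (remainder n) = [:eigval (n - 1):] * remainder n"
proof -
  let ?u = "M (remainder n) - [:eigval (n - 1):] * remainder n"
  have "degree (remainder n) \<le> n"
    by (rule degree_le) (simp add: coeff_remainder_eq_0[OF n])
  then have "12 * coeff (M (remainder n)) n = 0"
    using coeff_M[of "remainder n" n] coeff_remainder_eq_0[OF n] by simp
  then have "coeff ?u n = 0" using coeff_remainder_eq_0[OF n] by simp
  then have "?u = 0"
    using degree_eigenpoly[OF admissible M_M_remainder[OF n]]
    by (metis Suc_eq_plus1 leading_coeff_0_iff old.nat.inject)
  then show ?thesis by simp
qed

text \<open>
  The coefficient of \<open>x\<^sup>n\<^sup>-\<^sup>2\<close> in the eigenvalue equation of \<open>q\<^sub>n\<close>, for \<open>n = m + 2\<close>. The factor on the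
  left is the difference \<open>\<mu>\<^sub>n - \<mu>\<^sub>n\<^sub>-\<^sub>1\<close>; it does not vanish, so the equation determines the second
  coefficient of \<open>q\<^sub>n\<close>, which has degree \<open>n - 1\<close>.
\<close>
lemma second_coeff_q:
  "(2 * a * of_nat (Suc m) + d) * coeff (q (m + 2)) m
    = (of_nat (m + 2) * k (m + 2)) * of_nat (Suc m)
      * ((b + h / 2 * (d + 2 * a)) * of_nat m + e')"
proof -
  let ?\<mu> = "of_nat m :: 'a" and ?s = "coeff (q (m + 2)) m"
  have "12 * (eigval (m + 2) * ?s) = 12 * (?\<mu> * (a * (?\<mu> + 1) + d)) * ?s
    + (?\<mu> + 1) * (12 * b * ?\<mu> + 6 * (d + 2 * a) * h * ?\<mu> + 12 * e') * (of_nat (m + 2) * k (m + 2))"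
    using coeff_M[of "q (m + 2)" m] degree_q[of "m + 2"] coeff_q[of "Suc m"]
      coeff_q_eq_0[of "m + 2" "m + 2"]
    by (simp add: M_q)
  moreover have "eigval (m + 2) = ?\<mu> * (a * (?\<mu> + 1) + d) + (2 * a * (?\<mu> + 1) + d)"
    unfolding eigval_def of_nat_add of_nat_numeral by algebra
  moreover have "6 * (d + 2 * a) * h * ?\<mu> = 12 * (h / 2) * (d + 2 * a) * ?\<mu>" by simp
  ultimately have "12 * ((2 * a * (?\<mu> + 1) + d) * ?s)
    = 12 * ((of_nat (m + 2) * k (m + 2)) * (?\<mu> + 1) * ((b + h / 2 * (d + 2 * a)) * ?\<mu> + e'))"
    by algebra
  then show ?thesis
    by (metis mult_left_cancel zero_neq_numeral of_nat_Suc add.commute)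
qed

text \<open>
  The coefficient of \<open>x\<^sup>n\<^sup>-\<^sup>3\<close> in the same equation, with \<open>\<mu>\<^sub>n - \<mu>\<^sub>n\<^sub>-\<^sub>2\<close> on the left. It is stated for
  \<open>x q\<^sub>n\<close> to include \<open>m = 0\<close>, where the third coefficient is absent and both sides vanish.
\<close>
lemma third_coeff_q:
  fixes m :: nat
  defines "\<mu> \<equiv> of_nat m :: 'a"
  shows "12 * (2 * a * (\<mu> + 1) + d - a) * coeff (X * q (m + 2)) m
    = \<mu> * (6 * (b + h / 2 * (d + 2 * a)) * (\<mu> - 1) + 6 * e') * coeff (q (m + 2)) m
      + (\<mu> + 1) * \<mu> * (2 * a * (h / 2)^2 * (\<mu> - 1) * (\<mu> - 2) + 6 * c
          + 4 * (d + 2 * a) * (h / 2)^2 * (\<mu> - 1) + 6 * e' * (h / 2))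
        * (of_nat (m + 2) * k (m + 2))"
proof (cases m)
  case 0
  then show ?thesis by (simp add: \<mu>_def)
next
  case (Suc i)
  let ?s = "coeff (q (m + 2)) m" and ?t = "coeff (X * q (m + 2)) m"
  define \<eta> where "\<eta> = h / 2"
  have h: "h = 2 * \<eta>" by (simp add: \<eta>_def)
  have i: "of_nat i = \<mu> - 1" by (simp add: \<mu>_def Suc)
  have "12 * (eigval (m + 2) * ?t) = 12 * (of_nat i * (a * (of_nat i + 1) + d)) * ?t
    + (of_nat i + 1) * (12 * b * of_nat i + 6 * (d + 2 * a) * h * of_nat i + 12 * e') * ?s
    + (of_nat i + 1) * (of_nat i + 2) * (a * h^2 * of_nat i * (of_nat i - 1) + 12 * c
        + 2 * (d + 2 * a) * h^2 * of_nat i + 6 * e' * h) * (of_nat (m + 2) * k (m + 2))"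
    using coeff_M[of "q (m + 2)" i] degree_q[of "m + 2"] coeff_q[of "Suc m"]
    by (simp add: M_q Suc)
  moreover have "eigval (m + 2) = (\<mu> - 1) * (a * (\<mu> - 1 + 1) + d) + 2 * (2 * a * (\<mu> + 1) + d - a)"
    unfolding eigval_def of_nat_add of_nat_numeral \<mu>_def[symmetric] by algebra
  ultimately have "2 * (12 * (2 * a * (\<mu> + 1) + d - a) * ?t) = 2 * (
      \<mu> * (6 * (b + \<eta> * (d + 2 * a)) * (\<mu> - 1) + 6 * e') * coeff (q (m + 2)) m
      + (\<mu> + 1) * \<mu> * (2 * a * \<eta>^2 * (\<mu> - 1) * (\<mu> - 2) + 6 * c
          + 4 * (d + 2 * a) * \<eta>^2 * (\<mu> - 1) + 6 * e' * \<eta>)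
        * (of_nat (m + 2) * k (m + 2)))"
    unfolding i h by algebra
  then show ?thesis unfolding \<eta>_def by (metis mult_left_cancel zero_neq_numeral)
qed

text \<open>
  For \<open>n = m + 2\<close> the right-hand side is the top coefficient of \<open>\<gamma>\<^sub>n q\<^sub>n\<^sub>-\<^sub>1\<close>. On the left the second and
  third coefficients of \<open>q\<^sub>n\<close> and \<open>q\<^sub>n\<^sub>+\<^sub>1\<close> enter, the latter multiplied by \<open>\<alpha>\<^sub>n\<close> so that the leading
  coefficients agree; after that \<open>gamma_identity\<close> applies.
\<close>
lemma coeff_remainder: "coeff (remainder (m + 2)) m = \<gamma> (m + 2) * (of_nat (m + 1) * k (m + 1))"
proof -
  let ?n = "m + 2"
  define \<mu> :: 'a where "\<mu> = of_nat m"
  have \<mu>: "of_nat (m + 1) = \<mu> + 1" "of_nat (Suc m) = \<mu> + 1" "of_nat (m + 2) = \<mu> + 2"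
    "of_nat (Suc (Suc m)) = \<mu> + 2"
    by (simp_all add: \<mu>_def)
  have nat3: "m + 1 + 2 = m + 3" "Suc (m + 1) = m + 2" by simp_all
  have minus: "\<mu> + 1 - 1 = \<mu>" "\<mu> + 1 - 2 = \<mu> - 1" "\<mu> + 1 - 3 = \<mu> - 2" "\<mu> + 1 + 1 = \<mu> + 2"
    by simp_all
  have \<mu>': "of_nat (m + 3) = \<mu> + 3" by (simp add: \<mu>_def)
  define P where "P = 2 * a * (\<mu> + 1) + d"
  define \<kappa> where "\<kappa> = (\<mu> + 2) * k (m + 2)"
  define s t s1 t1 where "s = coeff (q ?n) m" and "t = coeff (X * q ?n) m"
    and "s1 = \<alpha> ?n * coeff (q (m + 3)) (m + 1)" and "t1 = \<alpha> ?n * coeff (q (m + 3)) m"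
  have P: "P \<noteq> 0" "P - a \<noteq> 0" "P + a \<noteq> 0" "P + 2 * a \<noteq> 0"
    using denominators_nonzero[of ?n] by (simp_all add: P_def \<mu>_def algebra_simps)
  have \<alpha>\<kappa>: "\<alpha> ?n * ((\<mu> + 3) * k (m + 3)) = \<kappa>"
    using alpha_lead[of ?n] by (simp add: \<kappa>_def \<mu>_def eval_nat_numeral algebra_simps)
  have "(t - t1 - \<beta> ?n * s) * ((P + a) * (P - a) * P^2) = - G ?n * (P - a * (\<mu> + 1)) * (\<mu> + 1) * \<kappa>"
  proof (rule gamma_identity[where h = h and r = "h / 2" and d = d and b = b and e = e and e' = e'
        and g = "b + h / 2 * (d + 2 * a)" and c = c and s' = s1 and t' = t1])
    show "h = 2 * (h / 2)" by simp
    show "d = P - 2 * a * (\<mu> + 1)" by (simp add: P_def)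
    show "b = b + h / 2 * (d + 2 * a) - h / 2 * (d + 2 * a)" by simp
    show "e = e' - h * d - b - h * a" by (simp add: e'_def)
    show "G ?n = (\<mu> + 1) * (P - a * (\<mu> + 1)) * (h^2 * (a * (\<mu> + 1) * d + a^2 * (\<mu> + 1)^2)
      - h * d * b + 4 * c * a + 2 * h * e * a - b^2) - d * b * e + d^2 * c + a * e^2"
      unfolding G_def Let_def \<mu> P_def by algebra
    show "P * s = \<kappa> * (\<mu> + 1) * ((b + h / 2 * (d + 2 * a)) * (\<mu> + 1 - 1) + e')"
      using second_coeff_q[of m] unfolding \<mu> \<mu>_def[symmetric]
      by (simp only: P_def s_def \<kappa>_def add_diff_cancel_right')
    have "\<alpha> ?n * ((P + 2 * a) * coeff (q (m + 3)) (m + 1))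
        = (\<alpha> ?n * ((\<mu> + 3) * k (m + 3))) * (\<mu> + 2) * ((b + h / 2 * (d + 2 * a)) * (\<mu> + 1) + e')"
    proof -
      have P2: "P + 2 * a = 2 * a * (\<mu> + 2) + d" by (simp add: P_def algebra_simps)
      show ?thesis
        using second_coeff_q[of "m + 1"] unfolding nat3 \<mu> \<mu>' P2 by (simp only: mult.assoc)
    qed
    then show "(P + 2 * a) * s1 = \<kappa> * (\<mu> + 1 + 1) * ((b + h / 2 * (d + 2 * a)) * (\<mu> + 1) + e')"
      unfolding \<alpha>\<kappa> s1_def by (simp add: algebra_simps)
    show "12 * (P - a) * t = (\<mu> + 1 - 1) * (6 * (b + h / 2 * (d + 2 * a)) * (\<mu> + 1 - 2) + 6 * e') * s
       + (\<mu> + 1) * (\<mu> + 1 - 1) * (2 * a * (h / 2)^2 * (\<mu> + 1 - 2) * (\<mu> + 1 - 3) + 6 * c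
         + 4 * (d + 2 * a) * (h / 2)^2 * (\<mu> + 1 - 2) + 6 * e' * (h / 2)) * \<kappa>"
      using third_coeff_q[of m] unfolding \<mu> \<mu>_def[symmetric] s_def[symmetric] t_def[symmetric] \<kappa>_def[symmetric]
      by (simp only: minus P_def)
    have "12 * (P + a) * t1 = \<alpha> ?n * (12 * (2 * a * (\<mu> + 1 + 1) + d - a) * coeff (X * q (m + 3)) (m + 1))"
      by (simp add: t1_def P_def numeral_3_eq_3) algebra
    also have "\<dots> = \<alpha> ?n * ((\<mu> + 1) * (6 * (b + h / 2 * (d + 2 * a)) * (\<mu> + 1 - 1) + 6 * e') * coeff (q (m + 3)) (m + 1)
       + (\<mu> + 1 + 1) * (\<mu> + 1) * (2 * a * (h / 2)^2 * (\<mu> + 1 - 1) * (\<mu> + 1 - 2) + 6 * c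
         + 4 * (d + 2 * a) * (h / 2)^2 * (\<mu> + 1 - 1) + 6 * e' * (h / 2)) * ((\<mu> + 3) * k (m + 3)))"
      using third_coeff_q[of "m + 1"] unfolding nat3 \<mu> \<mu>' by (simp only:)
    finally have t1: "12 * (P + a) * t1 = \<dots>" .
    show "12 * (P + a) * t1 = (\<mu> + 1) * (6 * (b + h / 2 * (d + 2 * a)) * (\<mu> + 1 - 1) + 6 * e') * s1
       + (\<mu> + 1 + 1) * (\<mu> + 1) * (2 * a * (h / 2)^2 * (\<mu> + 1 - 1) * (\<mu> + 1 - 2) + 6 * c
         + 4 * (d + 2 * a) * (h / 2)^2 * (\<mu> + 1 - 1) + 6 * e' * (h / 2)) * \<kappa>"
      unfolding t1 s1_def \<alpha>\<kappa>[symmetric] by algebra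
    have "\<beta> ?n * ((2 * a * (\<mu> + 2) - 2 * a + d) * (d + 2 * a * (\<mu> + 2)))
      = - (\<mu> + 2) * (d * h + 2 * a * h + 2 * b) * (d + a * (\<mu> + 2) - a) - d * (e - a * h - b)"
      using beta_mult[of ?n] unfolding \<mu> by simp
    moreover have "2 * (b + h / 2 * (d + 2 * a)) = 2 * b + h * (d + 2 * a)" by simp
    ultimately show "P * (P + 2 * a) * \<beta> ?n = - (2 * (b + h / 2 * (d + 2 * a))
        * ((\<mu> + 1) * (d + a * (\<mu> + 1 + 1))) + e' * d)"
      unfolding P_def e'_def by algebra
  qed (use P in auto)
  moreover have "coeff (remainder ?n) m = t - t1 - \<beta> ?n * s"
    by (simp add: remainder_def t_def t1_def s_def numeral_3_eq_3)
  moreover have "\<gamma> ?n * ((\<mu> + 1) * k (m + 1)) * ((P + a) * (P - a) * P^2)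
      = - G ?n * (P - a * (\<mu> + 1)) * (\<mu> + 1) * \<kappa>"
  proof -
    have eqs: "2 * a * (\<mu> + 2) - 2 * a + d = P" "d - a + 2 * a * (\<mu> + 2) = P + a"
      "d + 2 * a * (\<mu> + 2) - 3 * a = P - a" "d + a * (\<mu> + 2) - a = P - a * (\<mu> + 1)"
      unfolding P_def by algebra+
    have "\<gamma> ?n = - G ?n * ((P - a * (\<mu> + 1)) * (\<mu> + 2) / ((P + a) * (P - a) * P^2))
        * (k ?n / k (m + 1))"
      unfolding \<gamma>_def Let_def \<mu> eqs by simp
    then show ?thesis
      using P k_nonzero[of "m + 1"] by (simp add: \<kappa>_def)
  qed
  ultimately have "coeff (remainder ?n) m * ((P + a) * (P - a) * P^2)
      = \<gamma> ?n * ((\<mu> + 1) * k (m + 1)) * ((P + a) * (P - a) * P^2)"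
    by simp
  then show ?thesis unfolding \<mu> using P by (simp del: mult_cancel_left)
qed

text \<open>
  The difference of the remainder and \<open>\<gamma>\<^sub>n q\<^sub>n\<^sub>-\<^sub>1\<close> is an eigenvector whose eigenvalue forces the degree
  \<open>n - 2\<close>, but its coefficient of that degree vanishes. For \<open>n = 1\<close> the eigenvalue has no eigenvector
  at all.
\<close>
lemma X_mult_q:
  assumes n: "n \<ge> 1"
  shows "X * q n = [:\<alpha> n:] * q (n + 1) + [:\<beta> n:] * q n + [:\<gamma> n:] * q (n - 1)"
proof -
  let ?r = "remainder n - [:\<gamma> n:] * q (n - 1)"
  have eig: "M ?r = [:eigval (n - 1):] * ?r"
    unfolding M_diff M_const_mult M_remainder[OF n] M_q by algebra
  have "?r = 0"
  proof (rule ccontr)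
    assume "?r \<noteq> 0"
    with degree_eigenpoly[OF admissible eig] have deg: "n - 1 = Suc (degree ?r)" .
    then obtain m where m: "n = m + 2" "degree ?r = m"
      by (metis Suc_diff_1 add_2_eq_Suc' diff_is_0_eq' nat.distinct(1) not_gr_zero zero_le)
    have "coeff ?r m = 0"
      using coeff_remainder[of m] coeff_q[of m] by (simp add: m(1))
    with m(2) \<open>?r \<noteq> 0\<close> show False by (metis leading_coeff_0_iff)
  qed
  then show ?thesis unfolding remainder_def by algebra
qed

section \<open>Expansions of \<open>p\<^sub>n\<close> and \<open>\<sigma> E p\<^sub>n\<close>\<close>

definition "b_hat m = (let n = of_nat m in
     (h * (- 2 * a * n * (d + a * n - a) + a * d - d^2) - d * b + 2 * e * a)
       / ((2 * a * n - 2 * a + d) * (d + 2 * a * n)))"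
definition "c_hat m = (let n = of_nat m in
     G m * (a * n
          / ((d - a + 2 * a * n) * (d + 2 * a * n - 3 * a) * (2 * a * n - 2 * a + d)^2))
     * (k m / k (m - 1)))"
definition "b_prime m = (let n = of_nat m in
     - ((n - 1) * (a * n + d)
          * (h * (2 * a * n * d - a * d - 2 * a^2 * n + 2 * a^2 * n^2) - d * b + 2 * e * a)
        / ((2 * a * n - 2 * a + d) * (d + 2 * a * n))))"
definition "c_prime m = (let n = of_nat m in
     G m * ((d + a * n - a) * (a * n + d) * n
          / ((d - a + 2 * a * n) * (d + 2 * a * n - 3 * a) * (2 * a * n - 2 * a + d)^2))
     * (k m / k (m - 1)))"

lemma a_hat_alpha: "\<alpha> n = of_nat n * a_hat k n"
  by (simp add: alpha_star_def a_hat_def Let_def)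

text \<open>
  The common factor of \<open>\<gamma>\<close>, \<open>c_hat\<close> and \<open>c_prime\<close>. Their relations to each other are polynomial over
  it, so they hold even where a denominator is \<open>0\<close>.
\<close>
definition "\<Gamma> m = (let n = of_nat m in G m * (k m / k (m - 1))
  / ((d - a + 2 * a * n) * (d + 2 * a * n - 3 * a) * (2 * a * n - 2 * a + d)^2))"

lemma gamma_factor:
  "\<gamma> n = - \<Gamma> n * (d + a * of_nat n - a) * of_nat n"
  "c_hat n = \<Gamma> n * a * of_nat n"
  "c_prime n = \<Gamma> n * (d + a * of_nat n - a) * (a * of_nat n + d) * of_nat n"
  by (simp_all add: \<gamma>_def c_hat_def c_prime_def \<Gamma>_def Let_def ac_simps)

lemma beta_b_hat:
  assumes "n \<ge> 1"
  shows "2 * (of_nat n * (a * (of_nat n - 1) + d)) * b_hat n = \<beta> n * (d - 2 * a) - h * eigval n - e' + 2 * e"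
proof -
  define \<nu> :: 'a where "\<nu> = of_nat n"
  let ?P = "(2 * a * \<nu> - 2 * a + d) * (d + 2 * a * \<nu>)"
  have P: "?P \<noteq> 0" using denominators_nonzero[of n] assms by (simp add: \<nu>_def)
  have 1: "b_hat n * ?P = h * (- 2 * a * \<nu> * (d + a * \<nu> - a) + a * d - d^2) - d * b + 2 * e * a"
    using P by (simp add: b_hat_def Let_def \<nu>_def)
  have 2: "\<beta> n * ?P = - \<nu> * (d * h + 2 * a * h + 2 * b) * (d + a * \<nu> - a) - d * (e - a * h - b)"
    using beta_mult[OF assms] by (simp add: \<nu>_def)
  have "(2 * (\<nu> * (a * (\<nu> - 1) + d)) * b_hat n) * ?P = 2 * (\<nu> * (a * (\<nu> - 1) + d)) * (b_hat n * ?P)"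
    by algebra
  also have "\<dots> = (\<beta> n * ?P) * (d - 2 * a) - (h * eigval n + e' - 2 * e) * ?P"
    unfolding 1 2 eigval_def \<nu>_def[symmetric] e'_def by algebra
  also have "\<dots> = (\<beta> n * (d - 2 * a) - h * eigval n - e' + 2 * e) * ?P" by algebra
  finally show ?thesis using P by (metis \<nu>_def mult_right_cancel)
qed

text \<open>
  With \<open>l = n (a (n - 1) + d)\<close> the equation reads \<open>l p\<^sub>n = \<sigma> E p\<^sub>n + \<tau> q\<^sub>n\<close>, and \<open>E p\<^sub>n = D q\<^sub>n - h E q\<^sub>n\<close> by
  \<open>D_D\<close>. Hence \<open>2 l p\<^sub>n = (N - h M - \<tau>' + 2 \<tau>) q\<^sub>n\<close>, where \<open>N q\<^sub>n = (M - \<mu>\<^sub>n) (x q\<^sub>n)\<close>, and the expansion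
  of \<open>x q\<^sub>n\<close> can be inserted.
\<close>
lemma p_expansion:
  assumes n: "n \<ge> 1"
  shows "p n = [:a_hat k n:] * q (n + 1) + [:b_hat n:] * q n + [:c_hat n:] * q (n - 1)"
proof -
  define \<nu> :: 'a where "\<nu> = of_nat n"
  have \<nu>: "of_nat (n + 1) = \<nu> + 1" "of_nat (n - 1) = \<nu> - 1" "of_nat n = \<nu>"
    using n by (simp_all add: \<nu>_def)
  obtain m where m: "n = Suc m" using n by (cases n) auto
  define l where "l = \<nu> * (a * (\<nu> - 1) + d)"
  have "l \<noteq> 0"
    using admissible[of m] by (simp add: l_def \<nu>_def m mult.commute add.commute del: of_nat_Suc) simp
  have "eigenval a d n = - l"
    by (simp add: eigenval_def l_def \<nu>_def Let_def algebra_simps)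
  then have "[:l:] * p n = \<sigma> * E (p n) + \<tau> * q n"
    using equation[of n] by (simp add: q_def)
  also have "E (p n) = D (q n) - [:h:] * E (q n)"
    using D_D[of "p n"] unfolding q_def by algebra
  finally have "2 * ([:l:] * p n) = N (q n) - [:h:] * M (q n) - \<tau>' * q n + 2 * (\<tau> * q n)"
    unfolding N_def M_def by algebra
  also have "N (q n) = M (X * q n) - [:eigval n:] * (X * q n)"
    unfolding M_X_mult M_q by algebra
  also have "\<tau>' * q n = (2 * [:a:] + [:d:]) * (X * q n) + [:e':] * q n"
    unfolding \<tau>'_def const_double[symmetric] by (simp add: algebra_simps smult_add_left)
  finally have "2 * ([:l:] * p n) = M (X * q n) - ([:eigval n:] + 2 * [:a:] - [:d:]) * (X * q n)
      + (2 * [:e:] - [:e':] - [:h:] * [:eigval n:]) * q n"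
    unfolding M_q \<tau>_def by algebra
  also have "\<dots> = ([:\<alpha> n:] * ([:eigval (n + 1):] - [:eigval n:] - 2 * [:a:] + [:d:])) * q (n + 1)
    + ([:\<beta> n:] * ([:d:] - 2 * [:a:]) + 2 * [:e:] - [:e':] - [:h:] * [:eigval n:]) * q n
    + ([:\<gamma> n:] * ([:eigval (n - 1):] - [:eigval n:] - 2 * [:a:] + [:d:])) * q (n - 1)"
    unfolding X_mult_q[OF n] M_add M_const_mult M_q by algebra
  also have "[:\<alpha> n:] * ([:eigval (n + 1):] - [:eigval n:] - 2 * [:a:] + [:d:]) = [:2 * l * a_hat k n:]"
  proof -
    have "\<alpha> n * (eigval (n + 1) - eigval n - 2 * a + d) = 2 * l * a_hat k n"
      unfolding a_hat_alpha eigval_def l_def \<nu> by algebra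
    then show ?thesis unfolding const_double[symmetric] by (simp add: mult.commute)
  qed
  also have "[:\<beta> n:] * ([:d:] - 2 * [:a:]) + 2 * [:e:] - [:e':] - [:h:] * [:eigval n:] = [:2 * l * b_hat n:]"
    using beta_b_hat[OF n] unfolding const_double[symmetric] l_def \<nu>_def by simp
  also have "[:\<gamma> n:] * ([:eigval (n - 1):] - [:eigval n:] - 2 * [:a:] + [:d:]) = [:2 * l * c_hat n:]"
  proof -
    have "\<gamma> n * (eigval (n - 1) - eigval n - 2 * a + d) = 2 * l * c_hat n"
      unfolding gamma_factor eigval_def l_def \<nu> by algebra
    then show ?thesis unfolding const_double[symmetric] by (simp add: mult.commute)
  qed
  finally have "2 * ([:l:] * p n) = smult (2 * l)
      ([:a_hat k n:] * q (n + 1) + [:b_hat n:] * q n + [:c_hat n:] * q (n - 1))"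
    by (simp add: smult_add_right)
  also have "2 * ([:l:] * p n) = smult (2 * l) (p n)"
    by (simp add: numeral_poly mult.commute)
  finally show ?thesis
    using \<open>l \<noteq> 0\<close> by (metis mult_eq_0_iff smult_cancel zero_neq_numeral)
qed

lemma sigma_E_expansion:
  assumes n: "n \<ge> 1"
  shows "\<sigma> * E (p n) = [:a_prime a k n:] * q (n + 1) + [:b_prime n:] * q n + [:c_prime n:] * q (n - 1)"
proof -
  define \<nu> :: 'a where "\<nu> = of_nat n"
  define l where "l = \<nu> * (a * (\<nu> - 1) + d)"
  have "eigenval a d n = - l"
    by (simp add: eigenval_def l_def \<nu>_def Let_def algebra_simps)
  then have "\<sigma> * E (p n) + \<tau> * q n = [:l:] * p n"
    using equation[of n] by (simp add: q_def)
  then have "\<sigma> * E (p n) = [:l:] * p n - \<tau> * q n"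
    by (simp only: eq_diff_eq)
  also have "\<dots> = [:l:] * p n - [:d:] * (X * q n) - [:e:] * q n"
    unfolding \<tau>_def by algebra
  also have "\<dots> = ([:l:] * [:a_hat k n:] - [:d:] * [:\<alpha> n:]) * q (n + 1)
     + ([:l:] * [:b_hat n:] - [:d:] * [:\<beta> n:] - [:e:]) * q n
     + ([:l:] * [:c_hat n:] - [:d:] * [:\<gamma> n:]) * q (n - 1)"
    unfolding X_mult_q[OF n] by (subst p_expansion[OF n]) algebra
  also have "[:l:] * [:a_hat k n:] - [:d:] * [:\<alpha> n:] = [:a_prime a k n:]"
  proof -
    have "a_prime a k n = a * \<nu> * (\<nu> - 1) * a_hat k n"
      by (simp add: a_prime_def a_hat_def Let_def \<nu>_def)
    then have "l * a_hat k n - d * \<alpha> n = a_prime a k n"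
      unfolding a_hat_alpha l_def \<nu>_def by algebra
    then show ?thesis by (simp add: mult.commute)
  qed
  also have "[:l:] * [:b_hat n:] - [:d:] * [:\<beta> n:] - [:e:] = [:b_prime n:]"
  proof -
    let ?P = "(2 * a * \<nu> - 2 * a + d) * (d + 2 * a * \<nu>)"
    have P: "?P \<noteq> 0" using denominators_nonzero[of n] n by (simp add: \<nu>_def)
    have 1: "b_hat n * ?P = h * (- 2 * a * \<nu> * (d + a * \<nu> - a) + a * d - d^2) - d * b + 2 * e * a"
      using P by (simp add: b_hat_def Let_def \<nu>_def)
    have 2: "\<beta> n * ?P = - \<nu> * (d * h + 2 * a * h + 2 * b) * (d + a * \<nu> - a) - d * (e - a * h - b)"
      using beta_mult[OF assms] by (simp add: \<nu>_def)
    have 3: "b_prime n * ?P = - ((\<nu> - 1) * (a * \<nu> + d)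
          * (h * (2 * a * \<nu> * d - a * d - 2 * a^2 * \<nu> + 2 * a^2 * \<nu>^2) - d * b + 2 * e * a))"
      using P by (simp add: b_prime_def Let_def \<nu>_def)
    have "(l * b_hat n - d * \<beta> n - e) * ?P = l * (b_hat n * ?P) - d * (\<beta> n * ?P) - e * ?P"
      by algebra
    also have "\<dots> = b_prime n * ?P"
      unfolding 1 2 3 l_def by algebra
    finally have "l * b_hat n - d * \<beta> n - e = b_prime n" using P by (metis mult_right_cancel)
    then show ?thesis by (simp add: mult.commute)
  qed
  also have "[:l:] * [:c_hat n:] - [:d:] * [:\<gamma> n:] = [:c_prime n:]"
  proof -
    have "l * c_hat n - d * \<gamma> n = c_prime n"
      unfolding gamma_factor l_def \<nu>_def by algebra
    then show ?thesis by (simp add: mult.commute)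
  qed
  finally show ?thesis .
qed

end

section \<open>The continuous and the discrete case\<close>

lemma calculus_derivative: "step_calculus 0 pderiv (\<lambda>f. pderiv (pderiv f))"
  by unfold_locales
    (simp_all add: pderiv_add pderiv_smult pderiv_pCons pderiv_1 algebra_simps mult_2)

definition shift :: "'a::comm_ring_1 \<Rightarrow> 'a poly \<Rightarrow> 'a poly" where
  "shift r f = pcompose f [:r, 1:]"

lemma calculus_difference:
  "step_calculus 1 (\<lambda>f. shift 1 f - f) (\<lambda>f. shift 1 f - 2 * f + shift (- 1) f)"
  by unfold_locales
    (simp_all add: shift_def pcompose_1 pcompose_add pcompose_smult pcompose_pCons algebra_simps
      smult_diff_right smult_add_right)

theorem theorem1:
  fixes a b c d e :: "'a::field_char_0"
    and p :: "nat \<Rightarrow> 'a poly" and k :: "nat \<Rightarrow> 'a"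
  assumes admissible: "\<And>j::nat. d + of_nat j * a \<noteq> 0"
    and degree: "\<And>n. degree (p n) = n"
    and leading: "\<And>n. lead_coeff (p n) = k n"
    and nonzero: "\<And>n. k n \<noteq> 0"
  shows
    "((\<forall>n x. sigma a b c x * poly (pderiv (pderiv (p n))) x
           + tau d e x * poly (pderiv (p n)) x
           + eigenval a d n * poly (p n) x = 0)
      \<longrightarrow>
      (\<forall>n\<ge>1. \<forall>x.
         x * poly (pderiv (p n)) x
           = alpha_star k n * poly (pderiv (p (n + 1))) x
           + cont_beta_star a b d e n * poly (pderiv (p n)) x
           + cont_gamma_star a b c d e k n * poly (pderiv (p (n - 1))) x
       \<and> sigma a b c x * poly (pderiv (pderiv (p n))) x
           = a_prime a k n * poly (pderiv (p (n + 1))) x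
           + cont_b_prime a b d e n * poly (pderiv (p n)) x
           + cont_c_prime a b c d e k n * poly (pderiv (p (n - 1))) x
       \<and> poly (p n) x
           = a_hat k n * poly (pderiv (p (n + 1))) x
           + cont_b_hat a b d e n * poly (pderiv (p n)) x
           + cont_c_hat a b c d e k n * poly (pderiv (p (n - 1))) x))
   \<and>
     ((\<forall>n x. sigma a b c x * fwd_diff (bwd_diff (poly (p n))) x
           + tau d e x * fwd_diff (poly (p n)) x
           + eigenval a d n * poly (p n) x = 0)
      \<longrightarrow>
      (\<forall>n\<ge>1. \<forall>x.
         x * fwd_diff (poly (p n)) x
           = alpha_star k n * fwd_diff (poly (p (n + 1))) x
           + disc_beta_star a b d e n * fwd_diff (poly (p n)) x
           + disc_gamma_star a b c d e k n * fwd_diff (poly (p (n - 1))) x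
       \<and> sigma a b c x * fwd_diff (bwd_diff (poly (p n))) x
           = a_prime a k n * fwd_diff (poly (p (n + 1))) x
           + disc_b_prime a b d e n * fwd_diff (poly (p n)) x
           + disc_c_prime a b c d e k n * fwd_diff (poly (p (n - 1))) x
       \<and> poly (p n) x
           = a_hat k n * fwd_diff (poly (p (n + 1))) x
           + disc_b_hat a b d e n * fwd_diff (poly (p n)) x
           + disc_c_hat a b c d e k n * fwd_diff (poly (p (n - 1))) x))"
proof (intro conjI impI)
  assume eq: "\<forall>n x. sigma a b c x * poly (pderiv (pderiv (p n))) x
           + tau d e x * poly (pderiv (p n)) x + eigenval a d n * poly (p n) x = 0"
  interpret step_calculus 0 pderiv "\<lambda>f :: 'a poly. pderiv (pderiv f)"
    by (rule calculus_derivative)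
  interpret hypergeometric_calculus 0 pderiv "\<lambda>f. pderiv (pderiv f)" a b c d e ..
  interpret hypergeometric_family 0 pderiv "\<lambda>f. pderiv (pderiv f)" a b c d e p k
  proof
    show "\<sigma> * pderiv (pderiv (p n)) + \<tau> * pderiv (p n) + [:eigenval a d n:] * p n = 0" for n
      using eq unfolding poly_all_0_iff_0[symmetric]
      by (simp add: \<sigma>_def \<tau>_def sigma_def tau_def algebra_simps power2_eq_square)
  qed (fact admissible degree leading nonzero)+
  have b: "\<beta> n = cont_beta_star a b d e n" "b_hat n = cont_b_hat a b d e n"
    "b_prime n = cont_b_prime a b d e n" for n
    by (simp_all add: \<beta>_def b_hat_def b_prime_def cont_beta_star_def cont_b_hat_def
        cont_b_prime_def Let_def algebra_simps)
  have c: "\<gamma> n = cont_gamma_star a b c d e k n" "c_hat n = cont_c_hat a b c d e k n"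
    "c_prime n = cont_c_prime a b c d e k n" for n
  proof -
    let ?n = "of_nat n :: 'a"
    have G: "(?n - 1) * (d + a * ?n - a) * (4 * c * a - b^2) + a * e^2 + d^2 * c - b * e * d = G n"
      by (simp add: G_def Let_def algebra_simps)
    have factors: "d - 2 * a + 2 * a * ?n = 2 * a * ?n - 2 * a + d"
      "2 * a * ?n - 3 * a + d = d + 2 * a * ?n - 3 * a" "2 * a * ?n - a + d = d - a + 2 * a * ?n"
      "a * ?n + d - a = d + a * ?n - a"
      by simp_all
    show "\<gamma> n = cont_gamma_star a b c d e k n" "c_hat n = cont_c_hat a b c d e k n"
      "c_prime n = cont_c_prime a b c d e k n"
      unfolding \<gamma>_def c_hat_def c_prime_def cont_gamma_star_def cont_c_hat_def cont_c_prime_def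
        Let_def factors G by (simp_all add: ac_simps)
  qed
  note coeffs = b c
  have sigma: "poly \<sigma> x = sigma a b c x" for x
    by (simp add: \<sigma>_def sigma_def algebra_simps power2_eq_square)
  show "\<forall>n\<ge>1. \<forall>x.
         x * poly (pderiv (p n)) x
           = alpha_star k n * poly (pderiv (p (n + 1))) x
           + cont_beta_star a b d e n * poly (pderiv (p n)) x
           + cont_gamma_star a b c d e k n * poly (pderiv (p (n - 1))) x
       \<and> sigma a b c x * poly (pderiv (pderiv (p n))) x
           = a_prime a k n * poly (pderiv (p (n + 1))) x
           + cont_b_prime a b d e n * poly (pderiv (p n)) x
           + cont_c_prime a b c d e k n * poly (pderiv (p (n - 1))) x
       \<and> poly (p n) x
           = a_hat k n * poly (pderiv (p (n + 1))) x
           + cont_b_hat a b d e n * poly (pderiv (p n)) x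
           + cont_c_hat a b c d e k n * poly (pderiv (p (n - 1))) x"
  proof (intro allI impI, goal_cases)
    case (1 n x)
    note expansions = X_mult_q[OF 1] sigma_E_expansion[OF 1] p_expansion[OF 1]
    show ?case
      using expansions[THEN arg_cong[where f = "\<lambda>f. poly f x"]]
      unfolding coeffs[symmetric] sigma[symmetric] q_def
      by (simp only: poly_mult poly_add poly_pCons poly_0) simp
  qed
next
  assume eq: "\<forall>n x. sigma a b c x * fwd_diff (bwd_diff (poly (p n))) x
           + tau d e x * fwd_diff (poly (p n)) x + eigenval a d n * poly (p n) x = 0"
  define D E :: "'a poly \<Rightarrow> 'a poly"
    where "D f = shift 1 f - f" and "E f = shift 1 f - 2 * f + shift (- 1) f" for f
  have D: "fwd_diff (poly f) x = poly (D f) x" for f x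
    by (simp add: D_def shift_def fwd_diff_def poly_pcompose add.commute)
  have E: "fwd_diff (bwd_diff (poly f)) x = poly (E f) x" for f x
    by (simp add: E_def shift_def fwd_diff_def bwd_diff_def poly_pcompose algebra_simps)
  interpret step_calculus 1 D E
    unfolding D_def E_def by (rule calculus_difference)
  interpret hypergeometric_calculus 1 D E a b c d e ..
  have sigma: "poly \<sigma> x = sigma a b c x" for x
    by (simp add: \<sigma>_def sigma_def algebra_simps power2_eq_square)
  interpret hypergeometric_family 1 D E a b c d e p k
  proof
    show "\<sigma> * E (p n) + \<tau> * D (p n) + [:eigenval a d n:] * p n = 0" for n
      using eq unfolding poly_all_0_iff_0[symmetric] D E
      by (simp add: \<sigma>_def \<tau>_def sigma_def tau_def algebra_simps power2_eq_square)
  qed (fact admissible degree leading nonzero)+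
  have G: "G n = disc_G a b c d e n" for n
    by (simp add: G_def disc_G_def Let_def algebra_simps)
  have b: "\<beta> n = disc_beta_star a b d e n" "b_hat n = disc_b_hat a b d e n"
    "b_prime n = disc_b_prime a b d e n" for n
    by (simp_all add: \<beta>_def b_hat_def b_prime_def disc_beta_star_def disc_b_hat_def
        disc_b_prime_def Let_def algebra_simps)
  have c: "\<gamma> n = disc_gamma_star a b c d e k n" "c_hat n = disc_c_hat a b c d e k n"
    "c_prime n = disc_c_prime a b c d e k n" for n
    by (simp_all only: \<gamma>_def c_hat_def c_prime_def disc_gamma_star_def disc_c_hat_def
        disc_c_prime_def Let_def G)
  note coeffs = b c
  show "\<forall>n\<ge>1. \<forall>x.
         x * fwd_diff (poly (p n)) x
           = alpha_star k n * fwd_diff (poly (p (n + 1))) x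
           + disc_beta_star a b d e n * fwd_diff (poly (p n)) x
           + disc_gamma_star a b c d e k n * fwd_diff (poly (p (n - 1))) x
       \<and> sigma a b c x * fwd_diff (bwd_diff (poly (p n))) x
           = a_prime a k n * fwd_diff (poly (p (n + 1))) x
           + disc_b_prime a b d e n * fwd_diff (poly (p n)) x
           + disc_c_prime a b c d e k n * fwd_diff (poly (p (n - 1))) x
       \<and> poly (p n) x
           = a_hat k n * fwd_diff (poly (p (n + 1))) x
           + disc_b_hat a b d e n * fwd_diff (poly (p n)) x
           + disc_c_hat a b c d e k n * fwd_diff (poly (p (n - 1))) x"
  proof (intro allI impI, goal_cases)
    case (1 n x)
    note expansions = X_mult_q[OF 1] sigma_E_expansion[OF 1] p_expansion[OF 1]
    show ?case
      using expansions[THEN arg_cong[where f = "\<lambda>f. poly f x"]]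
      unfolding coeffs[symmetric] sigma[symmetric] D E q_def
      by (simp only: poly_mult poly_add poly_pCons poly_0) simp
  qed
qed

end
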